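(* For every positive integer $k$ there exists a constant $c$ (depending only on $k$) such that $$f(k,N)\leq\left\lfloor \frac{N}{k} \right\rfloor+c$$ for all positive integers $N$.
   Context: Let $k,N$ be positive integers and let $A,B$ be disjoint sets with $|A|=|B|=N$. For $S\subset A\cup B$ write $S_A=S\cap A$ and $S_B=S\cap B$. A family $\mathcal{S}$ of subsets of $A\cup B$ is called semiintersecting (with constants $k$ and $N$) if (i) $|S_A|=|S_B|=k$ for all $S\in\mathcal{S}$, and (ii) for all $S\neq T$ in $\mathcal{S}$, $S_A\cap T_A=\emptyset$ if and only if $S_B\cap T_B\neq\emptyset$. Define $f(k,N)$ to be the maximum of $|\mathcal{S}|$ over all semiintersecting families $\mathcal{S}$ with constants $k$ and $N$. *)

theory Defs
  imports Complex_Main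
begin

definition semiintersecting :: "nat \<Rightarrow> nat \<Rightarrow> 'a set \<Rightarrow> 'a set \<Rightarrow> 'a set set \<Rightarrow> bool" where
  "semiintersecting k N A B \<S> \<longleftrightarrow>
     finite A \<and> finite B \<and> A \<inter> B = {} \<and> card A = N \<and> card B = N \<and>
     (\<forall>S\<in>\<S>. S \<subseteq> A \<union> B) \<and>
     (\<forall>S\<in>\<S>. card (S \<inter> A) = k \<and> card (S \<inter> B) = k) \<and>
     (\<forall>S\<in>\<S>. \<forall>T\<in>\<S>. S \<noteq> T \<longrightarrow>
        ((S \<inter> A) \<inter> (T \<inter> A) = {} \<longleftrightarrow> (S \<inter> B) \<inter> (T \<inter> B) \<noteq> {}))"

text \<open>The ground sets range over sets of natural numbers. The lemmas below show that the maximum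
  is attained and that it bounds semiintersecting families over ground sets of any type, so that
  nothing is lost by this choice.\<close>

definition f :: "nat \<Rightarrow> nat \<Rightarrow> nat" where
  "f k N = Max {card \<S> | (A :: nat set) B \<S>. semiintersecting k N A B \<S>}"

lemma semiintersecting_card_le:
  assumes "semiintersecting k N A B \<S>"
  shows "card \<S> \<le> 2 ^ (2 * N)"
proof -
  have fin: "finite (A \<union> B)" and sub: "\<S> \<subseteq> Pow (A \<union> B)" and c: "card (A \<union> B) = 2 * N"
    using assms by (auto simp: semiintersecting_def card_Un_disjoint)
  show ?thesis
    using card_mono[OF _ sub] fin c by (simp add: card_Pow)
qed

lemma finite_semiintersecting_cards:
  "finite {card \<S> | (A :: nat set) B \<S>. semiintersecting k N A B \<S>}"
  by (rule finite_subset[of _ "{..2 ^ (2 * N)}"]) (auto dest: semiintersecting_card_le)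

lemma semiintersecting_image:
  assumes S: "semiintersecting k N A B \<S>" and h: "inj_on h (A \<union> B)"
  shows "semiintersecting k N (h ` A) (h ` B) ((`) h ` \<S>)"
    and "card ((`) h ` \<S>) = card \<S>"
proof -
  have sub: "S \<subseteq> A \<union> B" if "S \<in> \<S>" for S
    using S that by (auto simp: semiintersecting_def)
  have int: "h ` X \<inter> h ` Y = h ` (X \<inter> Y)" if "X \<subseteq> A \<union> B" "Y \<subseteq> A \<union> B" for X Y
    using inj_on_image_Int[OF h that] by simp
  have cd: "card (h ` X) = card X" if "X \<subseteq> A \<union> B" for X
    using card_image[OF inj_on_subset[OF h that]] .
  have inA: "h ` S \<inter> h ` A = h ` (S \<inter> A)" and inB: "h ` S \<inter> h ` B = h ` (S \<inter> B)"
    if "S \<in> \<S>" for S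
    using int sub[OF that] by simp_all
  have dA: "h ` (S \<inter> A) \<inter> h ` (T \<inter> A) = h ` (S \<inter> A \<inter> (T \<inter> A))"
    and dB: "h ` (S \<inter> B) \<inter> h ` (T \<inter> B) = h ` (S \<inter> B \<inter> (T \<inter> B))" for S T
    by (rule int; blast)+
  have cA: "card (h ` (S \<inter> A)) = card (S \<inter> A)" and cB: "card (h ` (S \<inter> B)) = card (S \<inter> B)" for S
    by (rule cd; blast)+
  show "semiintersecting k N (h ` A) (h ` B) ((`) h ` \<S>)"
    unfolding semiintersecting_def
  proof (intro conjI)
    show "finite (h ` A)" "finite (h ` B)"
      using S by (auto simp: semiintersecting_def)
    show "h ` A \<inter> h ` B = {}"
      using S int[of A B] by (simp add: semiintersecting_def)
    show "card (h ` A) = N" "card (h ` B) = N"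
      using S cd[of A] cd[of B] by (simp_all add: semiintersecting_def)
    show "\<forall>S\<in>(`) h ` \<S>. S \<subseteq> h ` A \<union> h ` B"
      using sub by blast
    show "\<forall>S\<in>(`) h ` \<S>. card (S \<inter> h ` A) = k \<and> card (S \<inter> h ` B) = k"
      using S by (auto simp: inA inB cA cB semiintersecting_def)
    show "\<forall>S\<in>(`) h ` \<S>. \<forall>T\<in>(`) h ` \<S>. S \<noteq> T \<longrightarrow>
        ((S \<inter> h ` A) \<inter> (T \<inter> h ` A) = {} \<longleftrightarrow> (S \<inter> h ` B) \<inter> (T \<inter> h ` B) \<noteq> {})"
    proof (intro ballI impI)
      fix S' T' assume "S' \<in> (`) h ` \<S>" "T' \<in> (`) h ` \<S>" and ne: "S' \<noteq> T'"
      then obtain P Q where P: "P \<in> \<S>" "S' = h ` P" and Q: "Q \<in> \<S>" "T' = h ` Q" by blast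
      with ne have "P \<noteq> Q" by blast
      then have "(P \<inter> A) \<inter> (Q \<inter> A) = {} \<longleftrightarrow> (P \<inter> B) \<inter> (Q \<inter> B) \<noteq> {}"
        using S P(1) Q(1) unfolding semiintersecting_def by blast
      then show "(S' \<inter> h ` A) \<inter> (T' \<inter> h ` A) = {} \<longleftrightarrow> (S' \<inter> h ` B) \<inter> (T' \<inter> h ` B) \<noteq> {}"
        unfolding P(2) Q(2) inA[OF P(1)] inB[OF P(1)] inA[OF Q(1)] inB[OF Q(1)] dA dB by simp
    qed
  qed
  have "inj_on ((`) h) \<S>"
    using inj_on_image_Pow[OF h] by (rule inj_on_subset) (use sub in blast)
  then show "card ((`) h ` \<S>) = card \<S>" by (rule card_image)
qed

lemma semiintersecting_card_le_f:
  fixes A B :: "'a set"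
  assumes "semiintersecting k N A B \<S>"
  shows "card \<S> \<le> f k N"
proof -
  have "finite (A \<union> B)" using assms by (simp add: semiintersecting_def)
  then obtain h :: "'a \<Rightarrow> nat" where h: "inj_on h (A \<union> B)"
    using finite_imp_inj_to_nat_seg by metis
  from semiintersecting_image[OF assms h] show ?thesis
    unfolding f_def by (intro Max_ge[OF finite_semiintersecting_cards] CollectI) metis
qed

lemma f_attained:
  fixes A B :: "'a set"
  assumes fin: "finite A" "finite B" and disj: "A \<inter> B = {}" and card: "card A = N" "card B = N"
  shows "\<exists>\<S>. semiintersecting k N A B \<S> \<and> card \<S> = f k N"
proof -
  let ?C = "{card \<S> | (A :: nat set) B \<S>. semiintersecting k N A B \<S>}"
  have "semiintersecting k N {..<N} {N..<2 * N} {}"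
    by (auto simp: semiintersecting_def)
  then have "?C \<noteq> {}" by blast
  then have "f k N \<in> ?C"
    unfolding f_def by (rule Max_in[OF finite_semiintersecting_cards])
  then obtain A' B' :: "nat set" and \<T> where T: "semiintersecting k N A' B' \<T>" "card \<T> = f k N"
    by force
  then have AB: "finite A'" "finite B'" "A' \<inter> B' = {}" "card A' = N" "card B' = N"
    by (auto simp: semiintersecting_def)
  obtain g1 where g1: "bij_betw g1 A' A"
    using finite_same_card_bij[of A' A] AB fin card by auto
  obtain g2 where g2: "bij_betw g2 B' B"
    using finite_same_card_bij[of B' B] AB fin card by auto
  define h where "h x = (if x \<in> A' then g1 x else g2 x)" for x
  have hA: "bij_betw h A' A"
    using g1 by (rule bij_betw_cong[THEN iffD1, rotated]) (simp add: h_def)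
  have hB: "bij_betw h B' B"
    using g2 by (rule bij_betw_cong[THEN iffD1, rotated]) (use AB in \<open>auto simp: h_def\<close>)
  have "inj_on h (A' \<union> B')"
    using bij_betw_combine[OF hA hB disj] by (simp add: bij_betw_def)
  from semiintersecting_image[OF T(1) this] show ?thesis
    using T(2) hA hB by (auto simp: bij_betw_def)
qed

end

theory Submission
  imports Defs
begin

text \<open>
  Two distinct members of a semiintersecting family meet in exactly one of \<open>A\<close> and \<open>B\<close>, so meeting
  in \<open>A\<close> is a graph on the family whose complement is meeting in \<open>B\<close>. If a member meets more
  than \<open>2k\<^sup>2\<close> others in \<open>A\<close>, then by pigeonhole one of its \<open>k\<close> points there lies in more than \<open>2k\<close>
  members, which therefore pairwise meet in \<open>A\<close>.
  The two sides cannot both carry such a cluster. On either side, a member meets at most \<open>k\<close> sets of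
  a family that is pairwise disjoint there, so the pairs between a cluster in \<open>A\<close> (pairwise disjoint in \<open>B\<close>)
  and a cluster in \<open>B\<close> (pairwise disjoint in \<open>A\<close>), each of which meets in \<open>A\<close> or in \<open>B\<close>,
  are too few (\<open>no_clusters_on_both_sides\<close>). Hence on one side, which may be taken to be \<open>A\<close>, every
  member meets at most \<open>2k\<^sup>2\<close> others; that is, it is disjoint in \<open>B\<close> from at most \<open>2k\<^sup>2\<close> others.

  Now split the family. The members that meet all members in \<open>B\<close> are pairwise disjoint in \<open>A\<close>, and
  so there are at most \<open>N div k\<close> of them. Each of the others has a partner disjoint from it in \<open>B\<close>,
  and all but \<open>2k\<^sup>2\<close> members meet this partner in \<open>B\<close>. A branching argument in the style of the set-pair inequality of
  Bollobas (\<open>card_containing_le\<close>) bounds the number of these in terms of \<open>k\<close> alone.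
\<close>

section \<open>Counting sets that meet a given set\<close>

lemma card_disjoint_family_le:
  assumes "finite I" "finite Y"
    and "\<And>i. i \<in> I \<Longrightarrow> g i \<subseteq> Y" "\<And>i. i \<in> I \<Longrightarrow> k \<le> card (g i)"
    and "\<And>i j. i \<in> I \<Longrightarrow> j \<in> I \<Longrightarrow> i \<noteq> j \<Longrightarrow> g i \<inter> g j = {}"
  shows "card I * k \<le> card Y"
proof -
  have "card I * k \<le> (\<Sum>i\<in>I. card (g i))"
    using sum_bounded_below[of I k "\<lambda>i. card (g i)"] assms(4) by simp
  also have "\<dots> = card (\<Union>i\<in>I. g i)"
    using assms by (intro card_UN_disjoint[symmetric]) (auto intro: finite_subset)
  also have "\<dots> \<le> card Y"
    using assms by (intro card_mono) auto
  finally show ?thesis .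
qed

lemma card_disjoint_family_meeting_le:
  assumes "finite I" "finite Q"
    and "\<And>i. i \<in> I \<Longrightarrow> g i \<inter> Q \<noteq> {}"
    and "\<And>i j. i \<in> I \<Longrightarrow> j \<in> I \<Longrightarrow> i \<noteq> j \<Longrightarrow> g i \<inter> g j = {}"
  shows "card I \<le> card Q"
proof -
  have "card I * 1 \<le> card Q"
  proof (rule card_disjoint_family_le[where g = "\<lambda>i. g i \<inter> Q"])
    show "1 \<le> card (g i \<inter> Q)" if "i \<in> I" for i
      using assms(2) assms(3)[OF that] by (simp add: Suc_le_eq card_gt_0_iff)
  qed (use assms in auto)
  then show ?thesis by simp
qed

lemma card_meeting_le:
  assumes "finite I" "finite Q"
    and "\<And>i. i \<in> I \<Longrightarrow> g i \<inter> Q \<noteq> {}"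
    and "\<And>x. x \<in> Q \<Longrightarrow> card {i \<in> I. x \<in> g i} \<le> m"
  shows "card I \<le> card Q * m"
proof -
  have "card I \<le> card (\<Union>x\<in>Q. {i \<in> I. x \<in> g i})"
    using assms by (intro card_mono) auto
  also have "\<dots> \<le> (\<Sum>x\<in>Q. card {i \<in> I. x \<in> g i})"
    by (rule card_UN_le[OF assms(2)])
  also have "\<dots> \<le> card Q * m"
    using sum_bounded_above[of Q "\<lambda>x. card {i \<in> I. x \<in> g i}" m] assms(4) by simp
  finally show ?thesis .
qed

text \<open>
  Branch on the sets that contain \<open>W\<close>: pick one of them and a set \<open>Q\<close> that is disjoint from it
  and met by all but \<open>D\<close> sets of the family. Then \<open>Q\<close> is disjoint from \<open>W\<close>, so every set containing \<open>W\<close> that meets \<open>Q\<close> contains one of the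
  at most \<open>k\<close> sets \<open>insert x W\<close> with \<open>x \<in> Q\<close>, which are larger than \<open>W\<close>. Only the at most \<open>D\<close> sets that
  miss \<open>Q\<close> escape, and they give the term \<open>D\<close> at each node of the branching. The branching ends when
  \<open>W\<close> has more than \<open>k\<close> points, so \<open>m\<close> bounds the remaining depth.
\<close>

lemma card_containing_le:
  fixes g :: "'i \<Rightarrow> 'b set"
  assumes fin: "finite X"
    and g: "\<And>i. i \<in> X \<Longrightarrow> finite (g i) \<and> card (g i) \<le> k"
    and partner: "\<And>i. i \<in> X \<Longrightarrow>
      \<exists>Q. finite Q \<and> card Q \<le> k \<and> Q \<inter> g i = {} \<and> card {j \<in> X. g j \<inter> Q = {}} \<le> D"
    and "finite W" "k < card W + m"
  shows "card {j \<in> X. W \<subseteq> g j} \<le> D * (\<Sum>i<m. k ^ i)"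
  using assms(4,5)
proof (induction m arbitrary: W)
  case 0
  have "\<not> W \<subseteq> g j" if "j \<in> X" for j
    using 0 g[OF that] card_mono[of "g j" W] by auto
  then have "{j \<in> X. W \<subseteq> g j} = {}" by blast
  then show ?case by (metis card.empty le0)
next
  case (Suc m)
  let ?Y = "{j \<in> X. W \<subseteq> g j}"
  show ?case
  proof (cases "?Y = {}")
    case True
    then show ?thesis by (metis card.empty le0)
  next
    case False
    then obtain i where i: "i \<in> X" "W \<subseteq> g i" by blast
    obtain Q where Q: "finite Q" "card Q \<le> k" "Q \<inter> g i = {}"
        "card {j \<in> X. g j \<inter> Q = {}} \<le> D"
      using partner[OF i(1)] by blast
    let ?M = "{j \<in> ?Y. g j \<inter> Q \<noteq> {}}"
    have "card {j \<in> ?M. x \<in> g j} \<le> D * (\<Sum>i<m. k ^ i)" if "x \<in> Q" for x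
    proof -
      have "x \<notin> W" using that Q(3) i(2) by blast
      then have "card {j \<in> X. insert x W \<subseteq> g j} \<le> D * (\<Sum>i<m. k ^ i)"
        using Suc.prems by (intro Suc.IH) auto
      moreover have "card {j \<in> ?M. x \<in> g j} \<le> card {j \<in> X. insert x W \<subseteq> g j}"
        using fin by (intro card_mono) auto
      ultimately show ?thesis by linarith
    qed
    then have "card ?M \<le> card Q * (D * (\<Sum>i<m. k ^ i))"
      using fin Q(1) by (intro card_meeting_le[where g = g]) auto
    also have "\<dots> \<le> k * (D * (\<Sum>i<m. k ^ i))"
      using Q(2) by (rule mult_le_mono1)
    finally have M: "card ?M \<le> k * (D * (\<Sum>i<m. k ^ i))" .
    have "card ?Y \<le> card ({j \<in> X. g j \<inter> Q = {}} \<union> ?M)"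
      using fin by (intro card_mono) auto
    also have "\<dots> \<le> D + k * (D * (\<Sum>i<m. k ^ i))"
      using card_Un_le[of "{j \<in> X. g j \<inter> Q = {}}" ?M] M Q(4) by linarith
    also have "\<dots> = D * (\<Sum>i<Suc m. k ^ i)"
      unfolding sum.lessThan_Suc_shift
      by (simp add: algebra_simps sum_distrib_left)
    finally show ?thesis .
  qed
qed

section \<open>The two sides of a semiintersecting family\<close>

lemma semiintersecting_swap:
  "semiintersecting k N A B \<S> \<Longrightarrow> semiintersecting k N B A \<S>"
  unfolding semiintersecting_def by (auto simp: Int_commute Un_commute)

lemma semiintersecting_finite:
  assumes "semiintersecting k N A B \<S>"
  shows "finite \<S>"
proof -
  have "\<S> \<subseteq> Pow (A \<union> B)" "finite (A \<union> B)"
    using assms unfolding semiintersecting_def by blast+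
  then show ?thesis by (metis finite_Pow_iff finite_subset)
qed

lemma semiintersecting_meet_iff:
  assumes "semiintersecting k N A B \<S>" "S \<in> \<S>" "T \<in> \<S>" "S \<noteq> T"
  shows "(S \<inter> A) \<inter> (T \<inter> A) = {} \<longleftrightarrow> (S \<inter> B) \<inter> (T \<inter> B) \<noteq> {}"
  using assms unfolding semiintersecting_def by blast

lemma semiintersecting_part:
  assumes "semiintersecting k N A B \<S>" "S \<in> \<S>"
  shows "finite (S \<inter> A)" "card (S \<inter> A) = k" "finite (S \<inter> B)" "card (S \<inter> B) = k"
  using assms unfolding semiintersecting_def by auto

text \<open>
  Between a cluster \<open>K\<close> on \<open>A\<close> and a cluster \<open>I\<close> on \<open>B\<close> there are few pairs that meet in \<open>A\<close>, because
  \<open>I\<close> is pairwise disjoint there and a member of \<open>K\<close> has only \<open>k\<close> points in \<open>A\<close>; symmetrically, few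
  pairs meet in \<open>B\<close>. Every pair does one or the other, also a pair of equal members, whose
  parts are nonempty.
\<close>

lemma no_clusters_on_both_sides:
  assumes S: "semiintersecting k N A B \<S>" and k: "k > 0"
    and K: "K \<subseteq> \<S>" "\<And>S T. S \<in> K \<Longrightarrow> T \<in> K \<Longrightarrow> (S \<inter> A) \<inter> (T \<inter> A) \<noteq> {}"
    and I: "I \<subseteq> \<S>" "\<And>S T. S \<in> I \<Longrightarrow> T \<in> I \<Longrightarrow> (S \<inter> B) \<inter> (T \<inter> B) \<noteq> {}"
  shows "card K \<le> 2 * k \<or> card I \<le> 2 * k"
proof -
  have fin: "finite K" "finite I"
    using K(1) I(1) semiintersecting_finite[OF S] by (auto intro: finite_subset)
  have meetA: "card {T \<in> I. (S \<inter> A) \<inter> (T \<inter> A) \<noteq> {}} \<le> k" if "S \<in> K" for S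
  proof -
    have "S \<in> \<S>" using that K(1) by blast
    have "card {T \<in> I. (S \<inter> A) \<inter> (T \<inter> A) \<noteq> {}} \<le> card (S \<inter> A)"
    proof (rule card_disjoint_family_meeting_le[where g = "\<lambda>T. T \<inter> A"])
      fix T U
      assume "T \<in> {T \<in> I. (S \<inter> A) \<inter> (T \<inter> A) \<noteq> {}}" "U \<in> {T \<in> I. (S \<inter> A) \<inter> (T \<inter> A) \<noteq> {}}" "T \<noteq> U"
      then show "(T \<inter> A) \<inter> (U \<inter> A) = {}"
        using semiintersecting_meet_iff[OF S, of T U] I by blast
    qed (use fin semiintersecting_part[OF S \<open>S \<in> \<S>\<close>] in auto)
    then show ?thesis using semiintersecting_part[OF S \<open>S \<in> \<S>\<close>] by simp
  qed
  \<comment> \<open>Here \<open>S\<close> and \<open>T\<close> are distinct, as \<open>T\<close> meets itself in \<open>A\<close>; so disjointness in \<open>A\<close> makes them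
    meet in \<open>B\<close>, where \<open>K\<close> is pairwise disjoint.\<close>
  have meetB: "card {S \<in> K. (S \<inter> A) \<inter> (T \<inter> A) = {}} \<le> k" if "T \<in> I" for T
  proof -
    have "T \<in> \<S>" using that I(1) by blast
    have "card {S \<in> K. (S \<inter> A) \<inter> (T \<inter> A) = {}} \<le> card (T \<inter> B)"
    proof (rule card_disjoint_family_meeting_le[where g = "\<lambda>S. S \<inter> B"])
      fix S' U
      assume *: "S' \<in> {S \<in> K. (S \<inter> A) \<inter> (T \<inter> A) = {}}" "U \<in> {S \<in> K. (S \<inter> A) \<inter> (T \<inter> A) = {}}" "S' \<noteq> U"
      then have "S' \<in> \<S>" "U \<in> \<S>" "(S' \<inter> A) \<inter> (U \<inter> A) \<noteq> {}" using K by auto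
      then show "(S' \<inter> B) \<inter> (U \<inter> B) = {}"
        using semiintersecting_meet_iff[OF S, of S' U] *(3) by blast
    next
      fix S'
      assume *: "S' \<in> {S \<in> K. (S \<inter> A) \<inter> (T \<inter> A) = {}}"
      have "T \<inter> A \<noteq> {}" using semiintersecting_part[OF S \<open>T \<in> \<S>\<close>] k by auto
      then have "S' \<noteq> T" using * by auto
      then show "(S' \<inter> B) \<inter> (T \<inter> B) \<noteq> {}"
        using * semiintersecting_meet_iff[OF S _ \<open>T \<in> \<S>\<close>, of S'] K(1) by blast
    qed (use fin semiintersecting_part[OF S \<open>T \<in> \<S>\<close>] in auto)
    then show ?thesis using semiintersecting_part[OF S \<open>T \<in> \<S>\<close>] by simp
  qed
  have "card K * card I = (\<Sum>T\<in>I. card K)" by simp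
  also have "\<dots> = (\<Sum>T\<in>I. card {S \<in> K. (S \<inter> A) \<inter> (T \<inter> A) \<noteq> {}} + card {S \<in> K. (S \<inter> A) \<inter> (T \<inter> A) = {}})"
    using fin by (intro sum.cong refl, subst card_Un_disjoint[symmetric]) (auto intro!: arg_cong[where f = card])
  also have "\<dots> = (\<Sum>S\<in>K. card {T \<in> I. (S \<inter> A) \<inter> (T \<inter> A) \<noteq> {}})
      + (\<Sum>T\<in>I. card {S \<in> K. (S \<inter> A) \<inter> (T \<inter> A) = {}})"
    unfolding sum.distrib
    by (subst sum_multicount_gen[OF fin, of "\<lambda>S T. (S \<inter> A) \<inter> (T \<inter> A) \<noteq> {}"]) auto
  also have "\<dots> \<le> card K * k + card I * k"
    using sum_bounded_above[of K _ k, OF meetA] sum_bounded_above[of I _ k, OF meetB]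
    by (simp add: add_mono)
  finally have "card K * card I \<le> card K * k + card I * k" .
  moreover have "card K * k + card I * k < card K * card I" if "2 * k < card K" "2 * k < card I"
  proof -
    have "2 * (card K * k) < card K * card I" "2 * (card I * k) < card K * card I"
      using mult_strict_left_mono[OF that(2), of "card K"] mult_strict_left_mono[OF that(1), of "card I"]
        that by (simp_all add: ac_simps)
    then show ?thesis by linarith
  qed
  ultimately show ?thesis by force
qed

lemma cluster_of_many_meeting:
  assumes S: "semiintersecting k N A B \<S>" and "S \<in> \<S>" and "X \<subseteq> \<S>"
    and meet: "\<And>T. T \<in> X \<Longrightarrow> (T \<inter> A) \<inter> (S \<inter> A) \<noteq> {}" and "k * m < card X"
  shows "\<exists>K \<subseteq> \<S>. m < card K \<and> (\<forall>T\<in>K. \<forall>U\<in>K. (T \<inter> A) \<inter> (U \<inter> A) \<noteq> {})"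
proof -
  have "\<exists>x \<in> S \<inter> A. m < card {T \<in> X. x \<in> T \<inter> A}"
  proof (rule ccontr)
    assume "\<not> ?thesis"
    then have "card X \<le> card (S \<inter> A) * m"
      using semiintersecting_part[OF S \<open>S \<in> \<S>\<close>] semiintersecting_finite[OF S] \<open>X \<subseteq> \<S>\<close> meet
      by (intro card_meeting_le[where g = "\<lambda>T. T \<inter> A"]) (auto intro: finite_subset simp: not_less)
    then show False
      using semiintersecting_part[OF S \<open>S \<in> \<S>\<close>] \<open>k * m < card X\<close> by simp
  qed
  then obtain x where "m < card {T \<in> X. x \<in> T \<inter> A}" by blast
  then show ?thesis
    using \<open>X \<subseteq> \<S>\<close> by (intro exI[of _ "{T \<in> X. x \<in> T \<inter> A}"]) auto
qed

text \<open>
  Members that are disjoint from some member in \<open>B\<close> are few by \<open>card_containing_le\<close>; the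
  remaining members pairwise meet in \<open>B\<close>, hence occupy disjoint parts of \<open>A\<close>.
\<close>

lemma card_le_of_few_disjoint:
  assumes S: "semiintersecting k N A B \<S>" and k: "k > 0"
    and few: "\<And>T. T \<in> \<S> \<Longrightarrow> card {S \<in> \<S>. (S \<inter> B) \<inter> (T \<inter> B) = {}} \<le> D"
  shows "card \<S> \<le> N div k + D * (\<Sum>i<Suc k. k ^ i)"
proof -
  define X where "X = {S \<in> \<S>. \<exists>T\<in>\<S>. (S \<inter> B) \<inter> (T \<inter> B) = {}}"
  have fin: "finite \<S>" by (rule semiintersecting_finite[OF S])
  have "card {S \<in> X. {} \<subseteq> S \<inter> B} \<le> D * (\<Sum>i<Suc k. k ^ i)"
  proof (rule card_containing_le[where g = "\<lambda>S. S \<inter> B"])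
    fix S' assume "S' \<in> X"
    then obtain T where T: "S' \<in> \<S>" "T \<in> \<S>" "(S' \<inter> B) \<inter> (T \<inter> B) = {}"
      by (auto simp: X_def)
    have "card {j \<in> X. (j \<inter> B) \<inter> (T \<inter> B) = {}} \<le> card {S \<in> \<S>. (S \<inter> B) \<inter> (T \<inter> B) = {}}"
      using fin by (intro card_mono) (auto simp: X_def)
    then show "\<exists>Q. finite Q \<and> card Q \<le> k \<and> Q \<inter> (S' \<inter> B) = {} \<and>
        card {j \<in> X. (j \<inter> B) \<inter> Q = {}} \<le> D"
      using few[OF T(2)] T(3) semiintersecting_part[OF S T(2)]
      by (intro exI[of _ "T \<inter> B"]) (simp add: Int_commute)
  next
    show "finite X" using fin by (simp add: X_def)
  next
    fix S' assume "S' \<in> X"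
    then show "finite (S' \<inter> B) \<and> card (S' \<inter> B) \<le> k"
      using semiintersecting_part[OF S, of S'] by (simp add: X_def)
  qed simp_all
  then have X: "card X \<le> D * (\<Sum>i<Suc k. k ^ i)" by simp
  have "card (\<S> - X) * k \<le> card A"
  proof (rule card_disjoint_family_le[where g = "\<lambda>S. S \<inter> A"])
    fix S' T assume *: "S' \<in> \<S> - X" "T \<in> \<S> - X" "S' \<noteq> T"
    then have "(S' \<inter> B) \<inter> (T \<inter> B) \<noteq> {}" by (auto simp: X_def)
    then show "(S' \<inter> A) \<inter> (T \<inter> A) = {}"
      using semiintersecting_meet_iff[OF S, of S' T] * by blast
  qed (use S fin semiintersecting_part[OF S] in \<open>auto simp: semiintersecting_def\<close>)
  then have "card (\<S> - X) \<le> N div k"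
    using S k by (simp add: semiintersecting_def less_eq_div_iff_mult_less_eq)
  moreover have "card \<S> = card X + card (\<S> - X)"
    using card_Int_Diff[OF fin, of X] by (simp add: X_def Int_def)
  ultimately show ?thesis using X by linarith
qed

lemma semiintersecting_card_le_div_add:
  assumes S: "semiintersecting k N A B \<S>" and k: "k > 0"
  shows "card \<S> \<le> N div k + k * (2 * k) * (\<Sum>i<Suc k. k ^ i)"
proof -
  have cluster: "\<exists>K \<subseteq> \<S>. 2 * k < card K \<and> (\<forall>T\<in>K. \<forall>U\<in>K. (T \<inter> A) \<inter> (U \<inter> A) \<noteq> {})"
    if S: "semiintersecting k N A B \<S>" and T: "T \<in> \<S>"
      and many: "k * (2 * k) < card {S \<in> \<S>. (S \<inter> B) \<inter> (T \<inter> B) = {}}" for A B T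
  proof (rule cluster_of_many_meeting[OF S T _ _ many])
    fix U assume U: "U \<in> {S \<in> \<S>. (S \<inter> B) \<inter> (T \<inter> B) = {}}"
    have "T \<inter> B \<noteq> {}" using semiintersecting_part[OF S T] k by auto
    then have "U \<noteq> T" using U by auto
    then show "(U \<inter> A) \<inter> (T \<inter> A) \<noteq> {}"
      using semiintersecting_meet_iff[OF S _ T, of U] U by blast
  qed auto
  show ?thesis
  proof (cases "\<forall>T\<in>\<S>. card {S \<in> \<S>. (S \<inter> B) \<inter> (T \<inter> B) = {}} \<le> k * (2 * k)")
    case True
    then show ?thesis using card_le_of_few_disjoint[OF S k] by blast
  next
    case False
    then obtain K where K: "K \<subseteq> \<S>" "2 * k < card K" "\<forall>T\<in>K. \<forall>U\<in>K. (T \<inter> A) \<inter> (U \<inter> A) \<noteq> {}"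
      using cluster[OF S] by (meson not_less)
    have "\<forall>T\<in>\<S>. card {S \<in> \<S>. (S \<inter> A) \<inter> (T \<inter> A) = {}} \<le> k * (2 * k)"
    proof (rule ccontr)
      assume "\<not> ?thesis"
      then obtain I where I: "I \<subseteq> \<S>" "2 * k < card I" "\<forall>T\<in>I. \<forall>U\<in>I. (T \<inter> B) \<inter> (U \<inter> B) \<noteq> {}"
        using cluster[OF semiintersecting_swap[OF S]] by (meson not_less)
      show False
        using no_clusters_on_both_sides[OF S k K(1) _ I(1)] K I by (meson not_less)
    qed
    then show ?thesis using card_le_of_few_disjoint[OF semiintersecting_swap[OF S] k] by blast
  qed
qed

theorem theorem2p4:
  fixes k :: nat
  assumes "k > 0"
  shows "\<exists>c :: int. \<forall>N :: nat. N > 0 \<longrightarrow> int (f k N) \<le> \<lfloor>real N / real k\<rfloor> + c"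
proof (intro exI allI impI)
  fix N :: nat
  have "\<exists>\<S>. semiintersecting k N {..<N} {N..<2 * N} \<S> \<and> card \<S> = f k N"
    by (rule f_attained) auto
  then have "f k N \<le> N div k + k * (2 * k) * (\<Sum>i<Suc k. k ^ i)"
    using semiintersecting_card_le_div_add[OF _ assms] by metis
  then have "int (f k N) \<le> int (N div k) + int (k * (2 * k) * (\<Sum>i<Suc k. k ^ i))"
    by linarith
  then show "int (f k N) \<le> \<lfloor>real N / real k\<rfloor> + int (k * (2 * k) * (\<Sum>i<Suc k. k ^ i))"
    by (simp only: floor_divide_of_nat_eq)
qed

end
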